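(* Let $X$ be an abelian group and let $S:X\times X\to X\times X$ be a map of the form $$S(x,y)=(ax+by+z,\ cx+dy+t),\qquad a,b,c,d\in\mathrm{End}\,X,\ z,t\in X.$$ Then $(X,S)$ is an affine solution if and only if $b$ and $c$ are invertible, the equations $$bab^{-1}=\frac{a}{a+1},\qquad c=b^{-1}(1-a^2),\qquad d=\frac{a}{a-1}$$ are satisfied, and $t=-b^{-1}(1+a)z$. Thus, such solutions are in one-to-one correspondence with triples $(a,b,z)$ ($a,b\in \mathrm{End}\,X$ with $b$ invertible, $z\in X$) such that $bab^{-1}=\frac{a}{a+1}$.
   Context: $\mathrm{End}\,X$ is the (not necessarily commutative) ring of endomorphisms of the abelian group $X$. Here $\frac{a}{a+1}=a(a+1)^{-1}$ and $\frac{a}{a-1}=a(a-1)^{-1}$, the equations being understood to include invertibility of the denominators in $\mathrm{End}\,X$. For a set $X$ and a bijection $S:X^2\to X^2$, $S=(S_1,S_2)$: $(X,S)$ is nondegenerate if for all fixed $y,w\in X$ the maps $x\mapsto S_2(x,y)$ and $x\mapsto S_1(w,x)$ are bijections; braided if $S^{12}S^{23}S^{12}=S^{23}S^{12}S^{23}$ on $X^3$; involutive if $S^2=\mathrm{id}$; symmetric if braided and involutive. An affine solution is a nondegenerate symmetric set $(X,S)$ where $X$ is an abelian group and $S$ is an affine linear transformation of $X\times X$, i.e. of the form in the claim. *)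

theory Defs
  imports Complex_Main
begin

section \<open>The endomorphism ring of an abelian group\<close>

typedef (overloaded) 'a endo = "{f :: 'a::ab_group_add \<Rightarrow> 'a. additive f}"
  morphisms app Endo
proof
  show "(\<lambda>x. x) \<in> {f :: 'a \<Rightarrow> 'a. additive f}"
    by (simp add: additive_def)
qed

setup_lifting type_definition_endo

lemma app_add [simp]: "app f (x + y) = app f x + app f y"
  by transfer (simp add: additive_def)

lemma app_zero [simp]: "app f 0 = 0"
  by transfer (rule additive.zero, simp)

lemma app_minus [simp]: "app f (- x) = - app f x"
  by transfer (rule additive.minus, simp)

lemma app_diff [simp]: "app f (x - y) = app f x - app f y"
  by transfer (rule additive.diff, simp)

lemma endo_eqI: "(\<And>x. app f x = app g x) \<Longrightarrow> f = g"
  by transfer auto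

text \<open>
  The endomorphism ring of the trivial group is the zero ring, so the type is not an instance of
  \<^class>\<open>ring_1\<close>, which requires \<open>0 \<noteq> 1\<close>; a possibly trivial ring with unit
  is expressed by the two classes \<^class>\<open>ring\<close> and \<^class>\<open>monoid_mult\<close>.
\<close>

instantiation endo :: (ab_group_add) "{ring, monoid_mult}"
begin

lift_definition zero_endo :: "'a endo" is "\<lambda>x. 0"
  by (simp add: additive_def)

lift_definition one_endo :: "'a endo" is "\<lambda>x. x"
  by (simp add: additive_def)

lift_definition plus_endo :: "'a endo \<Rightarrow> 'a endo \<Rightarrow> 'a endo" is "\<lambda>f g x. f x + g x"
  by (simp add: additive_def algebra_simps)

lift_definition minus_endo :: "'a endo \<Rightarrow> 'a endo \<Rightarrow> 'a endo" is "\<lambda>f g x. f x - g x"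
  by (simp add: additive_def algebra_simps)

lift_definition uminus_endo :: "'a endo \<Rightarrow> 'a endo" is "\<lambda>f x. - f x"
  by (simp add: additive_def algebra_simps)

lift_definition times_endo :: "'a endo \<Rightarrow> 'a endo \<Rightarrow> 'a endo" is "\<lambda>f g x. f (g x)"
  by (simp add: additive_def)

instance
  by standard (transfer, simp add: additive_def algebra_simps fun_eq_iff)+

end

lemma app_ring_ops [simp]:
  "app 0 x = 0"
  "app 1 x = x"
  "app (f + g) x = app f x + app g x"
  "app (f - g) x = app f x - app g x"
  "app (- f) x = - app f x"
  "app (f * g) x = app f (app g x)"
  by (transfer, simp)+

definition invertible :: "'r::monoid_mult \<Rightarrow> bool"
  where "invertible a \<longleftrightarrow> (\<exists>b. a * b = 1 \<and> b * a = 1)"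

text \<open>
  As \<^const>\<open>inverse\<close> is total, the inverse of a non-invertible endomorphism is the dummy
  value \<open>0\<close>. Invertibility of the elements being inverted therefore has to be stated separately.
  Division is multiplication by the inverse from the right.
\<close>

instantiation endo :: (ab_group_add) inverse
begin

definition inverse_endo :: "'a endo \<Rightarrow> 'a endo"
  where "inverse_endo a = (if invertible a then THE b. a * b = 1 \<and> b * a = 1 else 0)"

definition divide_endo :: "'a endo \<Rightarrow> 'a endo \<Rightarrow> 'a endo"
  where "divide_endo a b = a * inverse b"

instance ..

end

lemma
  fixes a :: "'a::ab_group_add endo"
  assumes "invertible a"
  shows endo_right_inverse: "a * inverse a = 1"
    and endo_left_inverse: "inverse a * a = 1"
proof -
  obtain b where b: "a * b = 1 \<and> b * a = 1"
    using assms by (auto simp: invertible_def)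
  have "c = b" if "a * c = 1 \<and> c * a = 1" for c
    using b that by (metis mult.assoc mult_1_left mult_1_right)
  then have "\<exists>!b. a * b = 1 \<and> b * a = 1"
    using b by blast
  from theI'[OF this] assms show "a * inverse a = 1" "inverse a * a = 1"
    by (simp_all add: inverse_endo_def)
qed


section \<open>Set-theoretical solutions\<close>

definition nondegenerate :: "('x \<times> 'x \<Rightarrow> 'x \<times> 'x) \<Rightarrow> bool"
  where "nondegenerate S \<longleftrightarrow>
    (\<forall>y. bij (\<lambda>x. snd (S (x, y)))) \<and> (\<forall>w. bij (\<lambda>x. fst (S (w, x))))"

definition S12 :: "('x \<times> 'x \<Rightarrow> 'x \<times> 'x) \<Rightarrow> 'x \<times> 'x \<times> 'x \<Rightarrow> 'x \<times> 'x \<times> 'x"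
  where "S12 S = (\<lambda>(x, y, w). case S (x, y) of (x', y') \<Rightarrow> (x', y', w))"

definition S23 :: "('x \<times> 'x \<Rightarrow> 'x \<times> 'x) \<Rightarrow> 'x \<times> 'x \<times> 'x \<Rightarrow> 'x \<times> 'x \<times> 'x"
  where "S23 S = (\<lambda>(x, y, w). case S (y, w) of (y', w') \<Rightarrow> (x, y', w'))"

definition braided :: "('x \<times> 'x \<Rightarrow> 'x \<times> 'x) \<Rightarrow> bool"
  where "braided S \<longleftrightarrow> S12 S \<circ> S23 S \<circ> S12 S = S23 S \<circ> S12 S \<circ> S23 S"

definition involutive :: "('x \<times> 'x \<Rightarrow> 'x \<times> 'x) \<Rightarrow> bool"
  where "involutive S \<longleftrightarrow> S \<circ> S = id"

definition symmetric :: "('x \<times> 'x \<Rightarrow> 'x \<times> 'x) \<Rightarrow> bool"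
  where "symmetric S \<longleftrightarrow> braided S \<and> involutive S"

definition affine_map ::
  "'a::ab_group_add endo \<Rightarrow> 'a endo \<Rightarrow> 'a endo \<Rightarrow> 'a endo \<Rightarrow> 'a \<Rightarrow> 'a \<Rightarrow> 'a \<times> 'a \<Rightarrow> 'a \<times> 'a"
  where "affine_map a b c d z t =
    (\<lambda>(x, y). (app a x + app b y + z, app c x + app d y + t))"

definition affine_solution :: "('a::ab_group_add \<times> 'a \<Rightarrow> 'a \<times> 'a) \<Rightarrow> bool"
  where "affine_solution S \<longleftrightarrow>
    bij S \<and> nondegenerate S \<and> symmetric S \<and> (\<exists>a b c d z t. S = affine_map a b c d z t)"

end

theory Submission
  imports Defs
begin

text \<open>
  The bijections required by nondegeneracy are translates of \<open>b\<close> and \<open>c\<close>, so nondegeneracy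
  means that \<open>b\<close> and \<open>c\<close> are invertible. Involutivity and the braid relation are equalities of
  affine maps, hence systems of equations for the coefficients, in the noncommutative ring
  \<open>End X\<close> and in \<open>X\<close> (\<open>involutive_affine_map_iff\<close>, \<open>braided_affine_map_iff\<close>).

  Involutivity contains \<open>a\<^sup>2 + b c = 1\<close>, \<open>a b + b d = 0\<close> and \<open>a z + b t + z = 0\<close>, which express
  \<open>c\<close>, \<open>d\<close> and \<open>t\<close> through \<open>a\<close>, \<open>b\<close> and \<open>z\<close>. Since \<open>(1 + a) (1 - a) = b c\<close> is invertible
  and its factors commute, \<open>1 + a\<close> and \<open>1 - a\<close> are invertible. The braid equation
  \<open>a\<^sup>2 + b a c = a\<close> then becomes \<open>b a b\<^sup>-\<^sup>1 = a / (a + 1)\<close>: multiplying it by \<open>1 + a\<close> from the left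
  gives \<open>(1 + a) b a c = a (1 - a\<^sup>2) = a b c\<close>, and \<open>c\<close> cancels.

  The result, \<open>a b = b a + a b a\<close>, is the form of the conjugation relation that makes everything
  computable (\<open>conjugation_iff\<close>). It turns \<open>b d = - a b\<close> into \<open>d = a / (a - 1)\<close> and back.
  Conversely, together with the formulas for \<open>c\<close>, \<open>d\<close> and \<open>t\<close> it implies all the remaining
  equations (\<open>affine_solution_sufficient\<close>), and it forces \<open>a - 1\<close> and \<open>c\<close> to be invertible,
  so every triple \<open>(a, b, z)\<close> with the conjugation relation arises. The triple is recovered from
  the map because an affine map determines its coefficients.
\<close>

section \<open>Invertible elements\<close>

lemma invertible_left_cancel:
  fixes u x y :: "'r::monoid_mult"
  assumes "invertible u"
  shows "u * x = u * y \<longleftrightarrow> x = y"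
  using assms unfolding invertible_def by (metis mult.assoc mult_1_left)

lemma invertible_right_cancel:
  fixes u x y :: "'r::monoid_mult"
  assumes "invertible u"
  shows "x * u = y * u \<longleftrightarrow> x = y"
  using assms unfolding invertible_def by (metis mult.assoc mult_1_right)

lemma invertible_mult:
  fixes u v :: "'r::monoid_mult"
  assumes "invertible u" "invertible v"
  shows "invertible (u * v)"
proof -
  obtain u' v' where "u * u' = 1" "u' * u = 1" "v * v' = 1" "v' * v = 1"
    using assms by (auto simp: invertible_def)
  then have "(u * v) * (v' * u') = 1" "(v' * u') * (u * v) = 1"
    by (metis mult.assoc mult_1_left)+
  then show ?thesis
    unfolding invertible_def by blast
qed

lemma invertible_commuting_factor:
  fixes u v :: "'r::monoid_mult"
  assumes "u * v = v * u" "invertible (u * v)"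
  shows "invertible u"
proof -
  obtain h where h: "u * v * h = 1" "h * (u * v) = 1"
    using assms by (auto simp: invertible_def)
  have right: "u * (v * h) = 1"
    using h by (simp add: mult.assoc)
  have left: "(h * v) * u = 1"
    using h assms by (simp add: mult.assoc)
  have "h * v = v * h"
    by (metis left right mult.assoc mult_1_left mult_1_right)
  then show ?thesis
    using left right unfolding invertible_def by metis
qed

lemma invertible_minus:
  fixes u :: "'r::{ring, monoid_mult}"
  assumes "invertible u"
  shows "invertible (- u)"
proof -
  obtain v where "u * v = 1" "v * u = 1"
    using assms by (auto simp: invertible_def)
  then have "(- u) * (- v) = 1" "(- v) * (- u) = 1"
    by simp_all
  then show ?thesis
    unfolding invertible_def by blast
qed

lemma invertible_inverse:
  fixes u :: "'a::ab_group_add endo"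
  assumes "invertible u"
  shows "invertible (inverse u)"
  using endo_left_inverse[OF assms] endo_right_inverse[OF assms]
  unfolding invertible_def by blast

lemma endo_eq_divide_iff:
  fixes u v w :: "'a::ab_group_add endo"
  assumes "invertible w"
  shows "u = v / w \<longleftrightarrow> u * w = v"
proof -
  have "v / w * w = v"
    by (simp add: divide_endo_def mult.assoc endo_left_inverse[OF assms])
  then show ?thesis
    using invertible_right_cancel[OF assms] by metis
qed

lemma endo_eq_inverse_mult_iff:
  fixes u v w :: "'a::ab_group_add endo"
  assumes "invertible w"
  shows "u = inverse w * v \<longleftrightarrow> w * u = v"
proof -
  have "w * (inverse w * v) = v"
    by (simp add: mult.assoc[symmetric] endo_right_inverse[OF assms])
  then show ?thesis
    using invertible_left_cancel[OF assms] by metis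
qed

lemma invertible_endo_iff_bij:
  fixes f :: "'a::ab_group_add endo"
  shows "invertible f \<longleftrightarrow> bij (app f)"
proof
  assume "invertible f"
  then obtain g where "f * g = 1" "g * f = 1"
    by (auto simp: invertible_def)
  then have "app f (app g x) = x" "app g (app f x) = x" for x
    by (metis app_ring_ops(2,6))+
  then show "bij (app f)"
    by (metis bijI')
next
  assume bij: "bij (app f)"
  let ?g = "inv (app f)"
  have fg: "app f (?g x) = x" and gf: "?g (app f x) = x" for x
    using bij by (simp_all add: bij_is_surj surj_f_inv_f bij_is_inj)
  have "additive ?g"
  proof
    fix x y
    show "?g (x + y) = ?g x + ?g y"
      by (metis app_add fg gf)
  qed
  then have "app (Endo ?g) = ?g"
    by (simp add: Endo_inverse)
  then have "f * Endo ?g = 1" "Endo ?g * f = 1"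
    by (auto intro!: endo_eqI simp: fg gf)
  then show "invertible f"
    unfolding invertible_def by blast
qed

lemma app_invertible_cancel:
  fixes f :: "'a::ab_group_add endo"
  assumes "invertible f"
  shows "app f x = app f y \<longleftrightarrow> x = y"
  using assms by (simp add: invertible_endo_iff_bij bij_is_inj inj_eq)


section \<open>The defining properties in terms of the coefficients\<close>

lemma affine_form_eq_iff:
  fixes f g h f' g' h' :: "'a::ab_group_add endo"
  shows "(\<forall>x y w. app f x + app g y + app h w + k = app f' x + app g' y + app h' w + k')
    \<longleftrightarrow> f = f' \<and> g = g' \<and> h = h' \<and> k = k'"
    (is "?L \<longleftrightarrow> ?R")
proof
  assume L: ?L
  from L[rule_format, of 0 0 0] have k: "k = k'" by simp
  show ?R
    using L[rule_format, of _ 0 0] L[rule_format, of 0 _ 0] L[rule_format, of 0 0] k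
    by (auto intro!: endo_eqI)
qed simp

lemma affine_map_eq_iff:
  "affine_map a b c d z t = affine_map a' b' c' d' z' t' \<longleftrightarrow>
    a = a' \<and> b = b' \<and> c = c' \<and> d = d' \<and> z = z' \<and> t = t'"
  using affine_form_eq_iff[of a b 0 z a' b' 0 z'] affine_form_eq_iff[of c d 0 t c' d' 0 t']
  by (auto simp: affine_map_def fun_eq_iff)

lemma affine_map_comp:
  "affine_map a b c d z t \<circ> affine_map a' b' c' d' z' t' =
    affine_map (a * a' + b * c') (a * b' + b * d') (c * a' + d * c') (c * b' + d * d')
      (app a z' + app b t' + z) (app c z' + app d t' + t)"
  by (auto simp: affine_map_def fun_eq_iff algebra_simps)

lemma involutive_affine_map_iff:
  "involutive (affine_map a b c d z t) \<longleftrightarrow>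
    a * a + b * c = 1 \<and> a * b + b * d = 0 \<and> c * a + d * c = 0 \<and> c * b + d * d = 1 \<and>
    app a z + app b t + z = 0 \<and> app c z + app d t + t = 0"
proof -
  have id: "id = affine_map (1 :: 'a endo) 0 0 1 0 0"
    by (auto simp: affine_map_def fun_eq_iff)
  show ?thesis
    by (simp add: involutive_def id affine_map_comp affine_map_eq_iff)
qed

text \<open>
  Both sides of the braid relation are affine maps of \<open>X\<^sup>3\<close>; the twelve coefficients on each
  side are compared. The coefficient of the last variable in the first component and that of the
  first variable in the last one agree automatically, which leaves ten equations.
\<close>

lemma braided_affine_map_iff:
  "braided (affine_map a b c d z t) \<longleftrightarrow>
    a * a + b * a * c = a \<and> a * b + b * a * d = b * a \<and> app a z + app b (app a t) = 0 \<and>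
    c * a + d * a * c = a * c \<and> c * b + d * a * d = a * d * a + b * c \<and>
    d * b = a * d * b + b * d \<and>
    app c z + app d (app a t) + app d z + t = app a (app d z) + app a t + app b t + z \<and>
    c * d = c * d * a + d * c \<and> d = c * d * b + d * d \<and> app c (app d z) + app d t = 0"
    (is "_ \<longleftrightarrow> ?R")
proof -
  let ?S = "affine_map a b c d z t"
  have left: "(S12 ?S \<circ> S23 ?S \<circ> S12 ?S) (x, y, w) =
     (app (a * a + b * a * c) x + app (a * b + b * a * d) y + app (b * b) w
        + (app a z + app b (app a t) + app b z + z),
      app (c * a + d * a * c) x + app (c * b + d * a * d) y + app (d * b) w
        + (app c z + app d (app a t) + app d z + t),
      app (c * c) x + app (c * d) y + app d w + (app c t + t))" for x y w
    by (simp add: S12_def S23_def affine_map_def algebra_simps)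
  have right: "(S23 ?S \<circ> S12 ?S \<circ> S23 ?S) (x, y, w) =
     (app a x + app (b * a) y + app (b * b) w + (app b z + z),
      app (a * c) x + app (a * d * a + b * c) y + app (a * d * b + b * d) w
        + (app a (app d z) + app a t + app b t + z),
      app (c * c) x + app (c * d * a + d * c) y + app (c * d * b + d * d) w
        + (app c (app d z) + app c t + app d t + t))" for x y w
    by (simp add: S12_def S23_def affine_map_def algebra_simps)
  have translations_eq: "app a z + app b (app a t) + app b z + z = app b z + z
      \<longleftrightarrow> app a z + app b (app a t) = 0"
    "app c t + t = app c (app d z) + app c t + app d t + t
      \<longleftrightarrow> app c (app d z) + app d t = 0"
    by (auto simp: algebra_simps)
  have "braided ?S \<longleftrightarrow> (\<forall>x y w. (S12 ?S \<circ> S23 ?S \<circ> S12 ?S) (x, y, w) =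
      (S23 ?S \<circ> S12 ?S \<circ> S23 ?S) (x, y, w))"
    by (simp only: braided_def fun_eq_iff split_paired_All)
  then show ?thesis
    by (simp only: left right prod.inject all_conj_distrib affine_form_eq_iff translations_eq
        simp_thms conj_assoc)
qed

lemma bij_add_const_iff:
  fixes f :: "'b \<Rightarrow> 'a::ab_group_add"
  shows "bij (\<lambda>x. f x + k) \<longleftrightarrow> bij f"
proof -
  have shift: "bij (\<lambda>x. g x + l)" if "bij g" for g :: "'b \<Rightarrow> 'a" and l
  proof -
    have "bij (\<lambda>u. l + u)" by (rule bij_plus)
    from bij_comp[OF that this] show ?thesis
      by (simp add: o_def add.commute)
  qed
  from shift[of "\<lambda>x. f x + k" "- k"] shift[of f k] show ?thesis
    by auto
qed

lemma nondegenerate_affine_map_iff: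
  "nondegenerate (affine_map a b c d z t) \<longleftrightarrow> invertible b \<and> invertible c"
proof -
  have "bij (\<lambda>x. snd (affine_map a b c d z t (x, y))) \<longleftrightarrow> invertible c" for y
    using bij_add_const_iff[of "app c" "app d y + t"]
    by (simp add: affine_map_def invertible_endo_iff_bij add.assoc)
  moreover have "bij (\<lambda>x. fst (affine_map a b c d z t (w, x))) \<longleftrightarrow> invertible b" for w
    using bij_add_const_iff[of "app b" "app a w + z"]
    by (simp add: affine_map_def invertible_endo_iff_bij algebra_simps)
  ultimately show ?thesis
    by (auto simp: nondegenerate_def)
qed

lemma affine_solution_affine_map_iff:
  "affine_solution (affine_map a b c d z t) \<longleftrightarrow> invertible b \<and> invertible c \<and>
    braided (affine_map a b c d z t) \<and> involutive (affine_map a b c d z t)"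
proof -
  have "bij S" if "involutive S" for S :: "'a \<times> 'a \<Rightarrow> 'a \<times> 'a"
    using that o_bij unfolding involutive_def by blast
  then show ?thesis
    unfolding affine_solution_def symmetric_def nondegenerate_affine_map_iff by blast
qed


section \<open>The relation between a and b\<close>

text \<open>
  Clearing denominators turns the conjugation relation into a polynomial one, which says that
  \<open>(1 + a) b a = a b\<close>: multiplication by \<open>1 + a\<close> moves \<open>a\<close> to the other side of \<open>b\<close>.
\<close>

lemma conjugation_iff:
  fixes a b :: "'a::ab_group_add endo"
  assumes b: "invertible b" and a1: "invertible (a + 1)"
  shows "b * a * inverse b = a / (a + 1) \<longleftrightarrow> a * b = b * a + a * b * a"
proof -
  have "(a + 1) * (a / (a + 1)) = a"
  proof -
    have "(a + 1) * a * inverse (a + 1) = a * (a + 1) * inverse (a + 1)"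
      by (simp add: algebra_simps)
    then show ?thesis
      by (simp add: divide_endo_def mult.assoc endo_right_inverse[OF a1])
  qed
  then have "b * a * inverse b = a / (a + 1) \<longleftrightarrow> (a + 1) * (b * a * inverse b) = a"
    using invertible_left_cancel[OF a1] by metis
  also have "\<dots> \<longleftrightarrow> (a + 1) * (b * a * inverse b) * b = a * b"
    using invertible_right_cancel[OF b] by metis
  also have "(a + 1) * (b * a * inverse b) * b = (a + 1) * (b * a)"
    by (simp add: mult.assoc endo_left_inverse[OF b])
  finally show ?thesis
    by (simp add: algebra_simps eq_commute)
qed

text \<open>
  The relation reads \<open>(1 + a) b (1 - a) = b\<close>, which expresses \<open>1 - a\<close> through invertible
  elements.
\<close>

lemma invertible_diff_1:
  fixes a b :: "'a::ab_group_add endo"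
  assumes b: "invertible b" and a1: "invertible (a + 1)" and R: "a * b = b * a + a * b * a"
  shows "invertible (a - 1)"
proof -
  have "(a + 1) * b * (1 - a) = b + (a * b - (b * a + a * b * a))"
    by (simp add: algebra_simps)
  then have "(a + 1) * b * (1 - a) = b"
    by (simp only: R[symmetric] diff_self add_0_right)
  then have "1 - a = inverse ((a + 1) * b) * b"
    using endo_eq_inverse_mult_iff[OF invertible_mult[OF a1 b]] by metis
  then have "invertible (1 - a)"
    using invertible_mult[OF invertible_inverse[OF invertible_mult[OF a1 b]] b] by simp
  from invertible_minus[OF this] show ?thesis
    by simp
qed

text \<open>
  The equation \<open>b c = 1 - a\<^sup>2\<close> makes the commuting factors of \<open>1 - a\<^sup>2\<close> invertible, and it allows
  \<open>c\<close> to be cancelled from \<open>(1 + a) b a c = a b c\<close>, which is the braid equation multiplied by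
  \<open>1 + a\<close>.
\<close>

lemma affine_solution_necessary:
  fixes a b c d :: "'a::ab_group_add endo"
  assumes b: "invertible b" and c: "invertible c"
    and bc: "b * c = 1 - a * a"
    and bd: "a * b + b * d = 0"
    and bac: "a * a + b * a * c = a"
  shows "invertible (a + 1)" "a * b = b * a + a * b * a" "d * (a - 1) = a"
proof -
  have factor: "(a + 1) * (1 - a) = b * c" "(1 - a) * (a + 1) = b * c"
    by (simp_all add: bc algebra_simps)
  show "invertible (a + 1)"
    by (rule invertible_commuting_factor[of _ "1 - a"])
       (simp_all only: factor invertible_mult[OF b c])
  have "(a + 1) * (b * a) * c = (a + 1) * (a - a * a)"
    using bac by (metis add_diff_cancel_left' mult.assoc)
  also have "\<dots> = a * (b * c)"
    by (simp add: bc algebra_simps)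
  finally have "(a + 1) * (b * a) * c = (a * b) * c"
    by (simp add: mult.assoc)
  then have "(a + 1) * (b * a) = a * b"
    by (simp only: invertible_right_cancel[OF c])
  then show R: "a * b = b * a + a * b * a"
    by (simp add: algebra_simps)
  have bd': "b * d = - (a * b)"
    using bd by (simp add: eq_neg_iff_add_eq_0 add.commute)
  have "b * (d * (a - 1)) = b * d * (a - 1)"
    by (simp add: mult.assoc)
  also have "\<dots> = a * b - a * b * a"
    by (simp add: bd' algebra_simps)
  also have "\<dots> = b * a"
    by (subst (1) R) simp
  finally show "d * (a - 1) = a"
    by (simp only: invertible_left_cancel[OF b])
qed

text \<open>
  For the converse, \<open>d = a / (a - 1)\<close> is used as \<open>a + d = a d = d a\<close>, which reduces every product
  of \<open>a\<close> and \<open>d\<close> in the braid equations to a sum. The relation between \<open>a\<close> and \<open>b\<close> then yields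
  \<open>b d = - a b\<close>, so that \<open>b\<close> conjugates \<open>d\<close> to \<open>- a\<close>. Since \<open>c\<close> and \<open>t\<close> are given by \<open>b c\<close> and
  \<open>b t\<close>, several equations are checked after applying \<open>b\<close> to both sides; where \<open>b\<close> is separated
  from \<open>c\<close> or \<open>t\<close> by a factor \<open>a\<close>, multiplication by \<open>1 + a\<close> turns \<open>b a\<close> into \<open>a b\<close>.
\<close>

lemma affine_solution_sufficient:
  fixes a b c d :: "'a::ab_group_add endo"
  assumes b: "invertible b" and a1: "invertible (a + 1)" and a2: "invertible (a - 1)"
    and R: "a * b = b * a + a * b * a"
    and bc: "b * c = 1 - a * a"
    and da1: "d * (a - 1) = a"
    and bt: "app b t = - app (1 + a) z"
  shows "braided (affine_map a b c d z t)" "involutive (affine_map a b c d z t)"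
proof -
  have da: "d * a = a + d"
    using da1 by (simp add: algebra_simps)
  have "(a * d) * (a - 1) = (d * a) * (a - 1)"
    using da1 da by (simp add: mult.assoc algebra_simps)
  then have ad: "a * d = a + d"
    using invertible_right_cancel[OF a2] da by metis
  have "(b * d) * (a - 1) = b * a"
    by (simp add: mult.assoc da1)
  also have "\<dots> = a * b - a * b * a"
    by (subst (1) R) simp
  also have "\<dots> = (- (a * b)) * (a - 1)"
    by (simp add: algebra_simps)
  finally have bd: "b * d = - (a * b)"
    by (simp only: invertible_right_cancel[OF a2])
  have "b * (c * a + d * c) = b * c * a + b * d * c"
    by (simp add: algebra_simps)
  also have "\<dots> = (b * c) * a - a * (b * c)"
    by (simp add: bd mult.assoc)
  also have "\<dots> = b * 0"
    by (simp add: bc algebra_simps)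
  finally have ca: "c * a + d * c = 0"
    by (simp only: invertible_left_cancel[OF b])
  have "b * d * d = a * a * b"
    by (simp add: bd mult.assoc)
  then have bdd: "b * (d * d) = a * a * b"
    by (simp only: mult.assoc)
  have "b * (c * b + d * d) = (b * c) * b + b * (d * d)"
    by (simp add: algebra_simps)
  also have "\<dots> = b * 1"
    by (simp add: bc bdd algebra_simps)
  finally have cb: "c * b + d * d = 1"
    by (simp only: invertible_left_cancel[OF b])
  have "(a + 1) * (b * a * c) = a * (b * c)"
    using arg_cong[OF R, of "\<lambda>u. u * c"] by (simp add: algebra_simps)
  also have "\<dots> = (a + 1) * (a - a * a)"
    by (simp add: bc algebra_simps)
  finally have bac: "b * a * c = a - a * a"
    by (simp only: invertible_left_cancel[OF a1])
  have db: "d * b = a * d * b + b * d"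
    by (simp add: ad bd algebra_simps)
  \<comment> \<open>\<open>d b - a d b = b d\<close> allows \<open>1 - a\<^sup>2 = (1 + a) (1 - a)\<close> to absorb the factor \<open>d b\<close>.\<close>
  have "b * (c * d * b) = (b * c) * d * b"
    by (simp add: mult.assoc)
  also have "\<dots> = (1 + a) * (d * b - a * d * b)"
    by (simp add: bc algebra_simps)
  also have "d * b - a * d * b = b * d"
    using db by (simp add: diff_eq_eq add.commute)
  also have "(1 + a) * (b * d) = b * (d - d * d)"
    by (simp add: bd bdd algebra_simps)
  finally have cdb: "c * d * b = d - d * d"
    by (simp only: invertible_left_cancel[OF b])

  have bt': "app b t = - z - app a z"
    using bt by simp
  have bdx: "app b (app d x) = - app a (app b x)" for x
    by (metis bd app_ring_ops(5,6))
  have bcx: "app b (app c x) = x - app a (app a x)" for x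
    using arg_cong[OF bc, of "\<lambda>f. app f x"] by simp
  have dax: "app d (app a x) = app a x + app d x" for x
    using arg_cong[OF da, of "\<lambda>f. app f x"] by simp
  have adx: "app a (app d x) = app a x + app d x" for x
    using arg_cong[OF ad, of "\<lambda>f. app f x"] by simp
  have Rx: "app a (app b x) = app b (app a x) + app a (app b (app a x))" for x
    using arg_cong[OF R, of "\<lambda>f. app f x"] by simp
  have "app b (app c z + app d t + t) = app b 0"
    by (simp add: bcx bdx bt')
  then have zt: "app c z + app d t + t = 0"
    by (simp only: app_invertible_cancel[OF b])
  have "app (a + 1) (app a z + app b (app a t)) =
      app a z + app a (app a z) + (app b (app a t) + app a (app b (app a t)))"
    by (simp add: algebra_simps)
  also have "\<dots> = app a z + app a (app a z) + app a (app b t)"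
    by (simp only: Rx[of t])
  also have "\<dots> = app (a + 1) 0"
    by (simp add: bt')
  finally have azt: "app a z + app b (app a t) = 0"
    by (simp only: app_invertible_cancel[OF a1])
  have "app b (app c (app d z) + app d t) = app b 0"
    by (simp add: bcx bdx bt' adx)
  then have cdz: "app c (app d z) + app d t = 0"
    by (simp only: app_invertible_cancel[OF b])

  show "involutive (affine_map a b c d z t)"
    using ca cb zt by (simp add: involutive_affine_map_iff bc bd bt')
  have "c * a + d * a * c = a * c"
    using ca by (simp add: da distrib_right add.left_commute)
  moreover have "c * b + d * a * d = a * d * a + b * c"
  proof -
    have "c * b + d * a * d = (c * b + d * d) + a * d"
      by (simp add: da algebra_simps)
    also have "\<dots> = a * d * a + b * c"
      by (simp add: cb ad bc da algebra_simps)
    finally show ?thesis .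
  qed
  moreover have "app c z + app d (app a t) + app d z + t =
      app a (app d z) + app a t + app b t + z"
  proof -
    have "app c z + app d (app a t) + app d z + t =
        (app c z + app d t + t) + app a t + app d z"
      by (simp add: dax algebra_simps)
    then show ?thesis
      by (simp add: zt adx bt')
  qed
  moreover have "c * d = c * d * a + d * c"
  proof -
    have "c * d * a + d * c = (c * a + d * c) + c * d"
      by (simp add: da mult.assoc algebra_simps)
    then show ?thesis
      by (simp add: ca)
  qed
  moreover have "a * b + b * a * d = b * a"
    by (simp add: mult.assoc ad distrib_left bd)
  ultimately show "braided (affine_map a b c d z t)"
    using azt cdz db by (simp add: braided_affine_map_iff bac cdb)
qed


section \<open>Affine solutions\<close>

lemma affine_solution_iff:
  fixes a b c d :: "'a::ab_group_add endo"
  shows "affine_solution (affine_map a b c d z t) \<longleftrightarrow>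
    invertible b \<and> invertible c \<and>
    (invertible (a + 1) \<and> b * a * inverse b = a / (a + 1)) \<and>
    c = inverse b * (1 - a\<^sup>2) \<and>
    (invertible (a - 1) \<and> d = a / (a - 1)) \<and>
    t = - app (inverse b * (1 + a)) z"
    (is "?L \<longleftrightarrow> ?R")
proof (cases "invertible b \<and> invertible c")
  case True
  then have b: "invertible b" and c: "invertible c"
    by auto
  have c_iff: "c = inverse b * (1 - a\<^sup>2) \<longleftrightarrow> b * c = 1 - a * a"
    by (simp add: endo_eq_inverse_mult_iff[OF b] power2_eq_square)
  have "app b (- app (inverse b * (1 + a)) z) = - app (1 + a) z"
    using endo_right_inverse[OF b] by (metis app_minus app_ring_ops(2,6))
  then have t_iff: "t = - app (inverse b * (1 + a)) z \<longleftrightarrow> app b t = - app (1 + a) z"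
    using app_invertible_cancel[OF b] by metis
  show ?thesis
  proof
    assume ?L
    then have inv: "a * a + b * c = 1" "a * b + b * d = 0" "app a z + app b t + z = 0"
      and br: "a * a + b * a * c = a"
      by (simp_all add: affine_solution_affine_map_iff involutive_affine_map_iff
          braided_affine_map_iff)
    have bc: "b * c = 1 - a * a"
      using inv(1) by (simp add: eq_diff_eq add.commute)
    note nec = affine_solution_necessary[OF b c bc inv(2) br]
    have a2: "invertible (a - 1)"
      by (rule invertible_diff_1[OF b nec(1,2)])
    have "app b t + app (1 + a) z = 0"
      using inv(3) by (simp add: algebra_simps)
    then have "app b t = - app (1 + a) z"
      by (simp only: eq_neg_iff_add_eq_0)
    then show ?R
      using b c bc nec a2 c_iff t_iff conjugation_iff[OF b nec(1)] endo_eq_divide_iff[OF a2]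
      by simp
  next
    assume R: ?R
    then have a1: "invertible (a + 1)" and a2: "invertible (a - 1)"
      by auto
    show ?L
      unfolding affine_solution_affine_map_iff
      using R b c c_iff t_iff conjugation_iff[OF b a1] endo_eq_divide_iff[OF a2]
        affine_solution_sufficient[OF b a1 a2]
      by blast
  qed
next
  case False
  then show ?thesis
    by (auto simp: affine_solution_affine_map_iff)
qed

text \<open>
  A triple determines a solution because \<open>a - 1\<close> and \<open>c\<close> are automatically invertible: the former
  by the relation between \<open>a\<close> and \<open>b\<close>, the latter since \<open>c = b\<^sup>-\<^sup>1 (1 - a) (1 + a)\<close>.
\<close>

lemma affine_solution_of_triple:
  fixes a b :: "'a::ab_group_add endo"
  assumes b: "invertible b" and a1: "invertible (a + 1)"
    and conj: "b * a * inverse b = a / (a + 1)"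
  shows "affine_solution (affine_map a b (inverse b * (1 - a\<^sup>2)) (a / (a - 1)) z
    (- app (inverse b * (1 + a)) z))"
proof -
  have a2: "invertible (a - 1)"
    using invertible_diff_1[OF b a1] conj conjugation_iff[OF b a1] by blast
  have "1 - a\<^sup>2 = - (a - 1) * (a + 1)"
    by (simp add: power2_eq_square algebra_simps)
  then have "invertible (1 - a\<^sup>2)"
    using invertible_mult[OF invertible_minus[OF a2] a1] by simp
  then have "invertible (inverse b * (1 - a\<^sup>2))"
    by (rule invertible_mult[OF invertible_inverse[OF b]])
  then show ?thesis
    using assms a2 by (simp add: affine_solution_iff)
qed

theorem proposition3p3:
  shows "(\<forall>(a :: 'a::ab_group_add endo) b c d z t.
            affine_solution (affine_map a b c d z t) \<longleftrightarrow>
              invertible b \<and> invertible c \<and>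
              (invertible (a + 1) \<and> b * a * inverse b = a / (a + 1)) \<and>
              c = inverse b * (1 - a\<^sup>2) \<and>
              (invertible (a - 1) \<and> d = a / (a - 1)) \<and>
              t = - app (inverse b * (1 + a)) z) \<and>
         bij_betw
           (\<lambda>(a :: 'a endo, b, z).
              affine_map a b (inverse b * (1 - a\<^sup>2)) (a / (a - 1)) z
                (- app (inverse b * (1 + a)) z))
           {(a, b, z). invertible b \<and> invertible (a + 1) \<and> b * a * inverse b = a / (a + 1)}
           {S. affine_solution S}"
    (is "?char \<and> bij_betw ?F ?T ?A")
proof
  show ?char
    using affine_solution_iff by blast
  have "inj_on ?F ?T"
    by (auto simp: inj_on_def affine_map_eq_iff)
  moreover have "?F ` ?T \<subseteq> ?A"
    by (clarsimp simp del: app_ring_ops) (rule affine_solution_of_triple)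
  moreover have "?A \<subseteq> ?F ` ?T"
  proof
    fix S :: "'a \<times> 'a \<Rightarrow> 'a \<times> 'a"
    assume "S \<in> ?A"
    then obtain a b c d z t where S: "S = affine_map a b c d z t"
      and sol: "affine_solution (affine_map a b c d z t)"
      unfolding affine_solution_def by blast
    note coeffs = sol[unfolded affine_solution_iff]
    have "(a, b, z) \<in> ?T"
      using coeffs by blast
    moreover have "S = ?F (a, b, z)"
      using coeffs S by simp
    ultimately show "S \<in> ?F ` ?T"
      by blast
  qed
  ultimately show "bij_betw ?F ?T ?A"
    by (simp add: bij_betw_def subset_antisym)
qed

end
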